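(* Let $a,b$ be coprime positive integers. Let $\approx$ be the equivalence relation on $\mathbb{Z}^b$ where $D\approx D'$ means $D$ can be converted to $D'$ by a finite sequence of (not necessarily legal) cluster-fire moves $\phi_S$ and borrow moves $\beta_T$ ($S,T\subseteq[b]$ arbitrary), and let $\mathcal{G}=\mathbb{Z}^b/{\approx}$. (a) Addition of integer vectors induces a well-defined group structure on $\mathcal{G}$, and this group is isomorphic to $\mathbb{Z}_a^{b-1}$ (the direct product of $b-1$ copies of the integers modulo $a$). (b) Every equivalence class in $\mathcal{G}$ contains a nonnegative configuration. (c) For any $D,D'\ge0$ in the same equivalence class, $D$ can be transformed into $D'$ by a finite sequence of cluster-fire and borrow moves all of which are legal. (d) For each $k$ with $0\le k<b$, each equivalence class contains exactly one $k$-skeletal chip configuration.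
   Context: Write $[b]=\{1,\dots,b\}$. A chip configuration is a function $D:[b]\to\mathbb{Z}$, identified with $(D(1),\dots,D(b))\in\mathbb{Z}^b$; $D\ge 0$ means all entries are nonnegative. For $S\subseteq[b]$ with $|S|=s$, the cluster-fire move $\phi_S$ subtracts $1+\lfloor (b-s)a/b\rfloor$ from $D(i)$ for each $i\in S$ and adds $\lfloor sa/b\rfloor$ to $D(j)$ for each $j\in[b]\setminus S$ ($\phi_\varnothing$ is the identity). The borrow move $\beta_S$ is the inverse map $\phi_S^{-1}$. For $D\ge0$, a move $\phi_S$ (resp. $\beta_S$) is legal on $D$ if $\phi_S(D)\ge 0$ (resp. $\beta_S(D)\ge0$); a sequence of moves is legal if each move is legal on the configuration it is applied to. For $0\le k<b$, a $k$-firing move is $\phi_S$ with $0<|S|\le k+1$; $D\ge0$ is $k$-stable if no $k$-firing move is legal on $D$. $D$ is $k$-skeletal if $D$ is $k$-stable and for every nonempty $T\subseteq[b]$ with $\beta_T$ legal on $D$, $\beta_T(D)$ is not $k$-stable. *)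

theory Defs
  imports Complex_Main "HOL-Algebra.Product_Groups" "HOL-Algebra.Elementary_Groups"
begin

(* A configuration is a function on {1..b}, represented as an element of the extensional
   function space {1..b} \<rightarrow>\<^sub>E UNIV; this is the carrier of the direct product of b copies of the
   integers, whose multiplication is addition of vectors. *)

abbreviation vec_group :: "nat \<Rightarrow> (nat \<Rightarrow> int) monoid" where
  "vec_group b \<equiv> product_group {1..b} (\<lambda>_. integer_group)"

definition configs :: "nat \<Rightarrow> (nat \<Rightarrow> int) set" where
  "configs b = carrier (vec_group b)"

definition nonneg :: "nat \<Rightarrow> (nat \<Rightarrow> int) \<Rightarrow> bool" where
  "nonneg b D \<longleftrightarrow> (\<forall>i\<in>{1..b}. 0 \<le> D i)"

definition fire :: "nat \<Rightarrow> nat \<Rightarrow> nat set \<Rightarrow> (nat \<Rightarrow> int) \<Rightarrow> (nat \<Rightarrow> int)" where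
  "fire a b S D = (\<lambda>i\<in>{1..b}.
     if i \<in> S then D i - (1 + \<lfloor>real ((b - card S) * a) / real b\<rfloor>)
     else D i + \<lfloor>real (card S * a) / real b\<rfloor>)"

definition borrow :: "nat \<Rightarrow> nat \<Rightarrow> nat set \<Rightarrow> (nat \<Rightarrow> int) \<Rightarrow> (nat \<Rightarrow> int)" where
  "borrow a b S = inv_into (configs b) (fire a b S)"

definition legal :: "nat \<Rightarrow> ((nat \<Rightarrow> int) \<Rightarrow> (nat \<Rightarrow> int)) \<Rightarrow> (nat \<Rightarrow> int) \<Rightarrow> bool" where
  "legal b \<phi> D \<longleftrightarrow> nonneg b D \<and> nonneg b (\<phi> D)"

definition moves :: "nat \<Rightarrow> nat \<Rightarrow> ((nat \<Rightarrow> int) \<Rightarrow> (nat \<Rightarrow> int)) set" where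
  "moves a b = fire a b ` Pow {1..b} \<union> borrow a b ` Pow {1..b}"

definition step :: "nat \<Rightarrow> nat \<Rightarrow> (nat \<Rightarrow> int) rel" where
  "step a b = {(D, \<phi> D) | D \<phi>. D \<in> configs b \<and> \<phi> \<in> moves a b}"

definition legal_step :: "nat \<Rightarrow> nat \<Rightarrow> (nat \<Rightarrow> int) rel" where
  "legal_step a b = {(D, \<phi> D) | D \<phi>. D \<in> configs b \<and> \<phi> \<in> moves a b \<and> legal b \<phi> D}"

(* The intersection only removes the pairs (D, D) with D not a configuration. *)

definition chip_equiv :: "nat \<Rightarrow> nat \<Rightarrow> (nat \<Rightarrow> int) rel" where
  "chip_equiv a b = (step a b)\<^sup>* \<inter> configs b \<times> configs b"

(* The product of two classes is defined as the union, over all representatives, of the class of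
   the sum; this is the class of the sum of any two representatives exactly when addition
   respects the relation. *)

definition chip_group :: "nat \<Rightarrow> nat \<Rightarrow> (nat \<Rightarrow> int) set monoid" where
  "chip_group a b =
     \<lparr>carrier = configs b // chip_equiv a b,
      monoid.mult = (\<lambda>X Y. \<Union>D\<in>X. \<Union>E\<in>Y. chip_equiv a b `` {D \<otimes>\<^bsub>vec_group b\<^esub> E}),
      one = chip_equiv a b `` {\<one>\<^bsub>vec_group b\<^esub>}\<rparr>"

definition k_stable :: "nat \<Rightarrow> nat \<Rightarrow> nat \<Rightarrow> (nat \<Rightarrow> int) \<Rightarrow> bool" where
  "k_stable a b k D \<longleftrightarrow> D \<in> configs b \<and> nonneg b D \<and>
     (\<forall>S \<subseteq> {1..b}. 0 < card S \<and> card S \<le> k + 1 \<longrightarrow> \<not> legal b (fire a b S) D)"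

definition k_skeletal :: "nat \<Rightarrow> nat \<Rightarrow> nat \<Rightarrow> (nat \<Rightarrow> int) \<Rightarrow> bool" where
  "k_skeletal a b k D \<longleftrightarrow> k_stable a b k D \<and>
     (\<forall>T \<subseteq> {1..b}. T \<noteq> {} \<and> legal b (borrow a b T) D \<longrightarrow> \<not> k_stable a b k (borrow a b T D))"

lemma configs_eq: "configs b = {1..b} \<rightarrow>\<^sub>E UNIV"
  by (simp add: configs_def integer_group_def)

lemma vec_group_mult: "D \<otimes>\<^bsub>vec_group b\<^esub> E = (\<lambda>i\<in>{1..b}. D i + E i)"
  by (simp add: integer_group_def)

lemma fire_empty: "D \<in> configs b \<Longrightarrow> fire a b {} D = D"
  by (auto simp: fire_def configs_eq PiE_def extensional_def restrict_def)

lemma bij_betw_fire: "bij_betw (fire a b S) (configs b) (configs b)"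
  by (rule bij_betwI[where g = "\<lambda>D. \<lambda>i\<in>{1..b}.
        if i \<in> S then D i + (1 + \<lfloor>real ((b - card S) * a) / real b\<rfloor>)
        else D i - \<lfloor>real (card S * a) / real b\<rfloor>"])
     (auto simp: fire_def configs_eq PiE_def extensional_def restrict_def)

lemma borrow_in_configs: "D \<in> configs b \<Longrightarrow> borrow a b S D \<in> configs b"
  and fire_borrow: "D \<in> configs b \<Longrightarrow> fire a b S (borrow a b S D) = D"
  and borrow_fire: "D \<in> configs b \<Longrightarrow> borrow a b S (fire a b S D) = D"
  using bij_betw_fire[of a b S]
  by (auto simp: borrow_def bij_betw_def inv_into_into f_inv_into_f)

lemma fire_in_configs: "D \<in> configs b \<Longrightarrow> fire a b S D \<in> configs b"
  using bij_betw_fire[of a b S] by (auto simp: bij_betw_def)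

lemma borrow_eq:
  assumes "D \<in> configs b"
  shows "borrow a b S D = (\<lambda>i\<in>{1..b}.
     if i \<in> S then D i + (1 + \<lfloor>real ((b - card S) * a) / real b\<rfloor>)
     else D i - \<lfloor>real (card S * a) / real b\<rfloor>)" (is "_ = ?E")
proof -
  have "?E \<in> configs b" by (simp add: configs_eq)
  moreover have "fire a b S ?E = D"
    using assms by (auto simp: fire_def configs_eq PiE_def extensional_def restrict_def)
  ultimately show ?thesis using borrow_fire by metis
qed

lemma sym_step: "sym (step a b)"
proof (rule symI)
  fix D E assume "(D, E) \<in> step a b"
  then obtain S where D: "D \<in> configs b" and S: "S \<in> Pow {1..b}"
    and E: "E = fire a b S D \<or> E = borrow a b S D"
    by (auto simp: step_def moves_def)
  then have "E \<in> configs b" "D = borrow a b S E \<or> D = fire a b S E"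
    using fire_in_configs borrow_in_configs borrow_fire fire_borrow by metis+
  with S show "(E, D) \<in> step a b"
    by (auto simp: step_def moves_def)
qed

lemma equiv_chip_equiv: "equiv (configs b) (chip_equiv a b)"
proof (rule equivI)
  show "chip_equiv a b \<subseteq> configs b \<times> configs b"
    by (auto simp: chip_equiv_def)
  show "refl_on (configs b) (chip_equiv a b)"
    by (auto simp: refl_on_def chip_equiv_def)
  show "sym (chip_equiv a b)"
    using sym_rtrancl[OF sym_step[of a b]] by (auto simp: chip_equiv_def sym_def)
  show "trans (chip_equiv a b)"
    by (auto simp: chip_equiv_def trans_def intro: rtrancl_trans)
qed

end

theory Submission
  imports Defs
begin

text \<open>
  Let \<open>f(s)\<close> be the largest integer below \<open>s a / b\<close>. By coprimality, firing a set \<open>S\<close> of size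
  \<open>s > 0\<close> adds \<open>f(s)\<close> everywhere and subtracts \<open>a\<close> on \<open>S\<close>. So two configurations are equivalent
  iff their difference is constant modulo \<open>a\<close>, which gives the group, and every firing strictly
  decreases the number of chips, so legal firing terminates. Stable configurations have entries in
  \<open>{0..<a}\<close>, and by coprimality equivalent ones are determined by their number of chips. If
  equivalent \<open>k\<close>-stable \<open>D\<close>, \<open>E\<close> are such that \<open>E\<close> has more chips, then some legal borrow keeps
  \<open>D\<close> \<open>k\<close>-stable. Hence the \<open>k\<close>-skeletal configuration of a class is its \<open>k\<close>-stable one with the
  most chips. A \<open>(b - 1)\<close>-stable configuration is automatically skeletal, so any two equivalent
  configurations can be joined by firing both down to the same one.
\<close>

section \<open>Cuts with few points before them\<close>

text \<open>\<open>P\<close> counts points on a line and a cut \<open>z\<close> is stable if for \<open>s \<le> k + 1\<close> fewer than \<open>s\<close>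
  points lie in the interval of length \<open>F s\<close> before \<open>z\<close>. Among the candidates \<open>F t\<close> with
  \<open>t \<ge> t\<^sub>0\<close>, the first one that is not preceded by too many points works: the preceding candidates
  control the intervals starting after \<open>F t\<^sub>0\<close>, and stability of \<open>y\<close> the others. The rounding error
  in \<open>sub\<close> is compensated by \<open>y < F t\<^sub>0\<close>, which is strict unless \<open>t = t\<^sub>0\<close>.\<close>

lemma next_stable_cut:
  fixes P :: "int \<Rightarrow> int" and F :: "nat \<Rightarrow> int"
  assumes P: "mono P" and F: "mono F"
    and super: "\<And>s t. F s + F t \<le> F (s + t)"
    and sub: "\<And>s t. F (s + t) \<le> F s + F t + 1"
    and last: "P (F b) \<le> int b"
    and y: "P y = int t\<^sub>0" "y \<le> F t\<^sub>0" "0 < t\<^sub>0" "t\<^sub>0 \<le> b"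
    and stable: "\<forall>s\<in>{1..k+1}. P y - P (y - F s) < int s"
  shows "\<exists>t\<in>{1..b}. P (F t) = int t \<and> (\<forall>s\<in>{1..k+1}. P (F t) - P (F t - F s) < int s)"
proof -
  define t where "t = (LEAST t. t\<^sub>0 \<le> t \<and> P (F t) \<le> int t)"
  have "t\<^sub>0 \<le> t \<and> P (F t) \<le> int t"
    unfolding t_def by (rule LeastI[of _ b]) (use y last in auto)
  then have t: "t\<^sub>0 \<le> t" "P (F t) \<le> int t" by auto
  have "t \<le> b" unfolding t_def by (rule Least_le) (use y last in auto)
  have less: "int j + 1 \<le> P (F j)" if "t\<^sub>0 \<le> j" "j < t" for j
    using not_less_Least[of j "\<lambda>t. t\<^sub>0 \<le> t \<and> P (F t) \<le> int t"] that unfolding t_def by fastforce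
  have Pm: "P u \<le> P v" if "u \<le> v" for u v using P that by (auto dest: monoD)
  show ?thesis
  proof (cases "t = t\<^sub>0")
    case True
    have eq: "P (F t) = int t" using Pm[OF y(2)] t y True by simp
    have "P (F t) - P (F t - F s) < int s" if "s \<in> {1..k+1}" for s
    proof -
      have "P (y - F s) \<le> P (F t - F s)" using y True by (intro Pm) simp
      then show ?thesis using bspec[OF stable that] eq y True by simp
    qed
    then show ?thesis using eq \<open>t \<le> b\<close> y True by (intro bexI[of _ t]) auto
  next
    case False
    then have lt: "t\<^sub>0 < t" using t by simp
    \<comment> \<open>The candidate before \<open>t\<close> was rejected, so its count is already at
      least \<open>t\<close>; with the bound defining \<open>t\<close> the count at
      \<open>F t\<close> is exactly \<open>t\<close>.\<close>
    have "int t \<le> P (F (t - 1))" using less[of "t - 1"] lt by simp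
    also have "\<dots> \<le> P (F t)" using F by (intro Pm) (simp add: monoD)
    finally have eq: "P (F t) = int t" using t by simp
    have y_less: "y < F t\<^sub>0"
      using less[of t\<^sub>0] lt y Pm[of "F t\<^sub>0" y] by linarith
    have "P (F t) - P (F t - F s) < int s" if s: "s \<in> {1..k+1}" for s
    proof (cases "t\<^sub>0 + s \<le> t")
      case True
      have "P (F (t - s)) \<le> P (F t - F s)"
        using super[of "t - s" s] True by (intro Pm) simp
      moreover have "int (t - s) + 1 \<le> P (F (t - s))" using less[of "t - s"] True s by simp
      ultimately show ?thesis using eq True by simp
    next
      case False
      \<comment> \<open>Only the part \<open>r\<close> of \<open>s\<close> is charged to the
        stability of \<open>y\<close>; the remaining \<open>d\<close> is the growth
        \<open>P (F t) - P y\<close>.\<close>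
      define d where "d = t - t\<^sub>0"
      define r where "r = s - d"
      have eqs: "t = t\<^sub>0 + d" "s = r + d" "0 < r" using lt False unfolding d_def r_def by auto
      have r: "r \<in> {1..k+1}" using s eqs by auto
      have "F t\<^sub>0 + F d \<le> F t" "F s \<le> F r + F d + 1" using super sub eqs by auto
      then have "P (y - F r) \<le> P (F t - F s)" using y_less by (intro Pm) linarith
      then show ?thesis using bspec[OF stable r] eq y eqs by simp
    qed
    then show ?thesis using eq \<open>t \<le> b\<close> y lt by (intro bexI[of _ t]) auto
  qed
qed

section \<open>Rounded levels\<close>

text \<open>The largest integer strictly below \<open>s a / b\<close>.\<close>

definition level :: "nat \<Rightarrow> nat \<Rightarrow> nat \<Rightarrow> int" where
  "level a b s = (int s * int a - 1) div int b"

text \<open>Turns the division into a Galois connection, so that later estimates on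
  \<open>level\<close> become linear inequalities.\<close>

lemma le_level_iff:
  assumes "0 < b"
  shows "m \<le> level a b s \<longleftrightarrow> m * int b < int s * int a"
proof
  assume "m \<le> level a b s"
  then have "m * int b \<le> level a b s * int b" by (simp add: mult_right_mono)
  also have "\<dots> \<le> int s * int a - 1"
    using assms div_mult_mod_eq[of "int s * int a - 1" "int b"]
      pos_mod_sign[of "int b" "int s * int a - 1"] unfolding level_def by linarith
  finally show "m * int b < int s * int a" by simp
next
  assume "m * int b < int s * int a"
  then have "m * int b div int b \<le> level a b s"
    unfolding level_def using assms by (intro zdiv_mono1) auto
  then show "m \<le> level a b s" using assms by simp
qed

lemma level_less: "0 < b \<Longrightarrow> level a b s * int b < int s * int a"
  using le_level_iff[of b "level a b s" a s] by simp

lemma le_level_Suc: "0 < b \<Longrightarrow> int s * int a \<le> (level a b s + 1) * int b"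
  using le_level_iff[of b "level a b s + 1" a s] by simp

lemma mono_level: "0 < b \<Longrightarrow> mono (level a b)"
  unfolding level_def by (intro monoI zdiv_mono1 diff_right_mono mult_right_mono) simp_all

lemma level_superadditive: "0 < b \<Longrightarrow> level a b s + level a b t \<le> level a b (s + t)"
  using level_less[of b a s] level_less[of b a t]
  by (simp add: le_level_iff distrib_right)

lemma level_subadditive:
  assumes "0 < b"
  shows "level a b (s + t) \<le> level a b s + level a b t + 1"
proof -
  have "level a b (s + t) * int b < (level a b s + level a b t + 2) * int b"
    using level_less[OF assms, of a "s + t"] le_level_Suc[OF assms, of s a]
      le_level_Suc[OF assms, of t a] by (simp add: algebra_simps)
  then show ?thesis using assms by (simp add: mult_less_cancel_right)
qed

lemma level_full:
  assumes "0 < b"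
  shows "level a b b = int a - 1"
proof (rule antisym)
  have "level a b b * int b < int a * int b" using level_less[OF assms, of a b] by (simp add: mult.commute)
  then show "level a b b \<le> int a - 1" using assms by (simp add: mult_less_cancel_right)
  show "int a - 1 \<le> level a b b" unfolding le_level_iff[OF assms] using assms by (simp add: algebra_simps)
qed

lemma floor_nat_divide_eq:
  assumes "m * int b \<le> int n" "int n < (m + 1) * int b"
  shows "\<lfloor>real n / real b\<rfloor> = m"
proof -
  have "0 < b" using assms by (cases "b = 0") auto
  then have "int n div int b = m"
    using assms by (intro int_div_pos_eq[where r = "int n - m * int b"]) (auto simp: algebra_simps)
  then show ?thesis by (simp add: floor_divide_of_nat_eq zdiv_int)
qed

section \<open>Quotients by kernel relations\<close>

text \<open>The fibre map \<open>g\<close> inverts the induced isomorphism, and the structure of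
  \<open>H\<close> is transported along it. \<open>Q\<close> has the form of
  \<open>chip_group\<close>, with its union product, so the result applies there by
  unfolding.\<close>

lemma quotient_by_kernel:
  assumes G: "group G" and H: "group H" and f: "f \<in> hom G H" "f ` carrier G = carrier H"
    and r: "\<And>x y. (x, y) \<in> r \<longleftrightarrow> x \<in> carrier G \<and> y \<in> carrier G \<and> f x = f y"
  defines "Q \<equiv> \<lparr>carrier = carrier G // r,
      monoid.mult = (\<lambda>X Y. \<Union>x\<in>X. \<Union>y\<in>Y. r `` {x \<otimes>\<^bsub>G\<^esub> y}),
      one = r `` {\<one>\<^bsub>G\<^esub>}\<rparr>"
  shows "(\<lambda>x y. r `` {x \<otimes>\<^bsub>G\<^esub> y}) respects2 r" "group Q" "Q \<cong> H"
proof -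
  interpret G: group G by fact
  interpret H: group H by fact
  have fm: "f (x \<otimes>\<^bsub>G\<^esub> y) = f x \<otimes>\<^bsub>H\<^esub> f y" if "x \<in> carrier G" "y \<in> carrier G" for x y
    using f that by (auto simp: hom_def)
  define g where "g h = {x \<in> carrier G. f x = h}" for h
  have rg: "r `` {x} = g (f x)" if "x \<in> carrier G" for x
    using that r by (auto simp: g_def)
  show "(\<lambda>x y. r `` {x \<otimes>\<^bsub>G\<^esub> y}) respects2 r"
    by (auto simp: congruent2_def r rg fm)
  have car: "g ` carrier H = carrier Q"
    unfolding Q_def by (auto simp: quotient_def rg simp flip: f(2))
  have ne: "\<exists>x\<in>carrier G. f x = h" if "h \<in> carrier H" for h
    using that by (auto simp flip: f(2))
  have mult: "g (h \<otimes>\<^bsub>H\<^esub> h') = g h \<otimes>\<^bsub>Q\<^esub> g h'" if "h \<in> carrier H" "h' \<in> carrier H" for h h'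
  proof -
    have "(\<Union>x\<in>g h. \<Union>y\<in>g h'. r `` {x \<otimes>\<^bsub>G\<^esub> y}) = (\<Union>x\<in>g h. \<Union>y\<in>g h'. g (h \<otimes>\<^bsub>H\<^esub> h'))"
      by (intro SUP_cong refl) (auto simp: rg g_def fm)
    also have "\<dots> = g (h \<otimes>\<^bsub>H\<^esub> h')" using ne that by (fastforce simp: g_def)
    finally show ?thesis by (simp add: Q_def)
  qed
  have hom: "g \<in> hom H Q" using mult car by (auto simp: hom_def)
  have one: "g \<one>\<^bsub>H\<^esub> = \<one>\<^bsub>Q\<^esub>"
    using rg[of "\<one>\<^bsub>G\<^esub>"] hom_one[OF f(1) G H] by (simp add: Q_def)
  have "inj_on g (carrier H)"
    using ne by (fastforce simp: inj_on_def g_def)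
  then have "g \<in> iso H Q" using hom car by (simp add: iso_def bij_betw_def)
  then show "Q \<cong> H" using H.iso_sym is_isoI by blast
  have "group (Q\<lparr>carrier := g ` carrier H, one := g \<one>\<^bsub>H\<^esub>\<rparr>)" by (rule H.hom_imp_img_group[OF hom])
  then show "group Q" by (simp add: car one)
qed

section \<open>Moves in terms of levels\<close>

context
  fixes a b :: nat
  assumes a: "0 < a" and b: "0 < b" and coprime: "coprime a b"
begin

lemma level_nonneg: "1 \<le> s \<Longrightarrow> 0 \<le> level a b s"
  using a b by (simp add: le_level_iff)

lemma level_less_a: "s \<le> b \<Longrightarrow> level a b s < int a"
  using monoD[OF mono_level[OF b], of s b a] level_full[OF b, of a] by simp

text \<open>Coprimality with \<open>0 < s < b\<close> keeps \<open>s * a / b\<close> from being an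
  integer, so its floor is the largest integer strictly below it.\<close>

lemma floor_eq_level:
  assumes "1 \<le> s" "s < b"
  shows "\<lfloor>real (s * a) / real b\<rfloor> = level a b s"
proof (rule floor_nat_divide_eq)
  have "\<not> b dvd s * a"
    using coprime assms by (auto simp: coprime_dvd_mult_left_iff coprime_commute dest: dvd_imp_le)
  then have "int (s * a) \<noteq> (level a b s + 1) * int b"
    by (metis dvd_triv_right of_nat_dvd_iff)
  then show "int (s * a) < (level a b s + 1) * int b"
    using le_level_Suc[OF b, of s a] by simp
qed (use level_less[OF b, of a s] in simp)

text \<open>The floor of \<open>a - x\<close> is \<open>a\<close> minus the ceiling of
  \<open>x\<close>, and \<open>level\<close> is one less than the ceiling of
  \<open>s * a / b\<close>.\<close>

lemma floor_eq_level_compl: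
  assumes "s \<le> b"
  shows "1 + \<lfloor>real ((b - s) * a) / real b\<rfloor> = int a - level a b s"
proof -
  have "\<lfloor>real ((b - s) * a) / real b\<rfloor> = int a - 1 - level a b s"
    using level_less[OF b, of a s] le_level_Suc[OF b, of s a] assms
    by (intro floor_nat_divide_eq) (simp_all add: of_nat_diff algebra_simps)
  then show ?thesis by simp
qed

lemma config_eqI: "D \<in> configs n \<Longrightarrow> E \<in> configs n \<Longrightarrow> (\<And>i. i \<in> {1..n} \<Longrightarrow> D i = E i) \<Longrightarrow> D = E"
  unfolding configs_eq by (rule PiE_ext)

lemma restrict_in_configs [simp]: "restrict f {Suc 0..n} \<in> configs n"
  by (simp add: configs_eq)

lemma restrict_config: "D \<in> configs n \<Longrightarrow> restrict D {Suc 0..n} = D"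
  by (rule config_eqI[of _ n]) auto

lemma card_bounds:
  assumes "S \<subseteq> {1..b}" "S \<noteq> {}"
  shows "1 \<le> card S" "card S \<le> b"
  using assms card_mono[of "{1..b}" S] finite_subset[of S "{1..b}"] card_0_eq[of S]
  by (auto simp: Suc_le_eq)

text \<open>The two floors combine into one common shift and a loss of \<open>a\<close> on
  \<open>S\<close>. The empty set is excluded because \<open>level a b 0 = -1\<close>, while firing
  it changes nothing.\<close>

lemma fire_eq_level:
  assumes S: "S \<subseteq> {1..b}" "S \<noteq> {}"
  shows "fire a b S D = (\<lambda>i\<in>{1..b}. D i + level a b (card S) - (if i \<in> S then int a else 0))"
proof (rule config_eqI[of _ b])
  fix i assume i: "i \<in> {1..b}"
  have "card S < b" if "i \<notin> S"
    using psubset_card_mono[of "{1..b}" S] S(1) i that by (simp add: psubset_eq set_eq_iff) blast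
  then show "fire a b S D i
      = (\<lambda>i\<in>{1..b}. D i + level a b (card S) - (if i \<in> S then int a else 0)) i"
    using i floor_eq_level_compl[of "card S"] floor_eq_level[of "card S"] card_bounds[OF S]
    by (auto simp: fire_def simp del: of_nat_mult)
qed (simp_all add: fire_def)

lemma borrow_eq_level:
  assumes D: "D \<in> configs b" and S: "S \<subseteq> {1..b}" "S \<noteq> {}"
  shows "borrow a b S D = (\<lambda>i\<in>{1..b}. D i - level a b (card S) + (if i \<in> S then int a else 0))"
    (is "_ = ?E")
proof -
  have "fire a b S ?E = D"
    unfolding fire_eq_level[OF S] by (rule config_eqI[of _ b]) (use D in auto)
  then show ?thesis using borrow_fire[of ?E b a S] by simp
qed

text \<open>With \<open>s = card S\<close>, the total changes by
  \<open>b * level a b s - s * a\<close>, which is negative because \<open>level\<close> is strictly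
  below the quotient.\<close>

lemma sum_fire_less:
  assumes S: "S \<subseteq> {1..b}" "S \<noteq> {}"
  shows "sum (fire a b S D) {1..b} < sum D {1..b}"
proof -
  have "sum (fire a b S D) {1..b}
      = sum D {1..b} + int b * level a b (card S) - (\<Sum>i\<in>{1..b}. if i \<in> S then int a else 0)"
    unfolding fire_eq_level[OF S] by (simp add: sum.distrib sum_subtractf)
  also have "(\<Sum>i\<in>{1..b}. if i \<in> S then int a else 0) = int (card S) * int a"
    using S by (simp add: sum.If_cases Int_absorb1)
  finally show ?thesis using level_less[OF b, of a "card S"] by (simp add: mult.commute)
qed

lemma sum_borrow_greater:
  assumes "D \<in> configs b" "S \<subseteq> {1..b}" "S \<noteq> {}"
  shows "sum D {1..b} < sum (borrow a b S D) {1..b}"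
  using sum_fire_less[OF assms(2,3), of "borrow a b S D"] assms(1) by (simp add: fire_borrow)

section \<open>Reachable displacements\<close>

text \<open>The displacements available from every configuration form a group under addition, so
  reachability reduces to exhibiting generators.\<close>

definition reach :: "(nat \<Rightarrow> int) set" where
  "reach = {u. \<forall>D\<in>configs b. (D, \<lambda>i\<in>{1..b}. D i + u i) \<in> (step a b)\<^sup>*}"

lemma reach_zero: "(\<lambda>_. 0) \<in> reach"
  by (auto simp: reach_def restrict_config)

lemma reach_cong:
  assumes "u \<in> reach" "\<And>i. i \<in> {1..b} \<Longrightarrow> u i = v i"
  shows "v \<in> reach"
proof -
  have "(\<lambda>i\<in>{1..b}. D i + u i) = (\<lambda>i\<in>{1..b}. D i + v i)" for D
    using assms(2) by auto
  then show ?thesis using assms(1) by (simp add: reach_def)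
qed

lemma reach_add:
  assumes "u \<in> reach" "v \<in> reach"
  shows "(\<lambda>i. u i + v i) \<in> reach"
  unfolding reach_def
proof (intro CollectI ballI)
  fix D assume D: "D \<in> configs b"
  let ?E = "\<lambda>i\<in>{1..b}. D i + u i"
  have "(D, ?E) \<in> (step a b)\<^sup>*" using assms(1) D by (auto simp: reach_def)
  moreover have "(?E, \<lambda>i\<in>{1..b}. ?E i + v i) \<in> (step a b)\<^sup>*"
    using assms(2) unfolding reach_def
    by (blast intro: restrict_in_configs[folded One_nat_def])
  moreover have "(\<lambda>i\<in>{1..b}. ?E i + v i) = (\<lambda>i\<in>{1..b}. D i + (u i + v i))"
    by (auto simp: add.assoc)
  ultimately show "(D, \<lambda>i\<in>{1..b}. D i + (u i + v i)) \<in> (step a b)\<^sup>*"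
    by (metis (no_types, lifting) rtrancl_trans)
qed

lemma reach_uminus:
  assumes "u \<in> reach"
  shows "(\<lambda>i. - u i) \<in> reach"
  unfolding reach_def
proof (intro CollectI ballI)
  fix D assume D: "D \<in> configs b"
  let ?E = "\<lambda>i\<in>{1..b}. D i + - u i"
  have eq: "(\<lambda>i\<in>{1..b}. ?E i + u i) = D"
    by (rule config_eqI[of _ b]) (use D in auto)
  have "(?E, \<lambda>i\<in>{1..b}. ?E i + u i) \<in> (step a b)\<^sup>*"
    using assms unfolding reach_def
    by (blast intro: restrict_in_configs[folded One_nat_def])
  then have "(?E, D) \<in> (step a b)\<^sup>*" unfolding eq .
  then show "(D, ?E) \<in> (step a b)\<^sup>*"
    using sym_rtrancl[OF sym_step] by (meson symD)
qed

lemma reach_mult: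
  assumes "u \<in> reach"
  shows "(\<lambda>i. n * u i) \<in> reach"
proof (induction n rule: int_induct[where k = 0])
  case base
  then show ?case using reach_zero by simp
next
  case (step1 n)
  then show ?case using reach_add[OF step1(2) assms] by (simp add: distrib_right)
next
  case (step2 n)
  then show ?case using reach_add[OF step2(2) reach_uminus[OF assms]] by (simp add: left_diff_distrib)
qed

lemma reach_borrow:
  assumes S: "S \<subseteq> {1..b}" "S \<noteq> {}"
  shows "(\<lambda>i. (if i \<in> S then int a else 0) - level a b (card S)) \<in> reach"
  unfolding reach_def
proof (intro CollectI ballI)
  fix D assume D: "D \<in> configs b"
  have "(D, borrow a b S D) \<in> step a b"
    using D S by (auto simp: step_def moves_def)
  moreover have "borrow a b S D
      = (\<lambda>i\<in>{1..b}. D i + ((if i \<in> S then int a else 0) - level a b (card S)))"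
    unfolding borrow_eq_level[OF D S] by auto
  ultimately show "(D, \<lambda>i\<in>{1..b}. D i + ((if i \<in> S then int a else 0) - level a b (card S)))
      \<in> (step a b)\<^sup>*" by auto
qed

text \<open>Borrowing the full set adds \<open>a - (a - 1) = 1\<close> everywhere.\<close>

lemma reach_const: "(\<lambda>_. c) \<in> reach"
proof -
  have "(\<lambda>_. 1) \<in> reach"
    by (rule reach_cong[OF reach_borrow[of "{1..b}"]]) (use b level_full[OF b, of a] in auto)
  then show ?thesis using reach_mult[of "\<lambda>_. 1" c] by simp
qed

text \<open>Borrowing \<open>{j}\<close> adds \<open>a\<close> at \<open>j\<close> and a constant
  everywhere, and constants can be removed.\<close>

lemma reach_unit:
  assumes "j \<in> {1..b}"
  shows "(\<lambda>i. if i = j then int a * n else 0) \<in> reach"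
proof -
  have "(\<lambda>i. if i = j then int a else 0) \<in> reach"
    using reach_add[OF reach_borrow[of "{j}"] reach_const[of "level a b 1"]] assms by simp
  from reach_mult[OF this, of n] show ?thesis
    by (rule reach_cong) (simp add: mult.commute)
qed

lemma reach_multiples: "(\<lambda>i. int a * v i) \<in> reach"
proof -
  have "(\<lambda>i. if i \<in> A then int a * v i else 0) \<in> reach" if "finite A" "A \<subseteq> {1..b}" for A
    using that
  proof (induction A)
    case empty
    then show ?case using reach_zero by simp
  next
    case (insert j A)
    then show ?case
      by (intro reach_cong[OF reach_add[OF insert.IH reach_unit[of j "v j"]]]) auto
  qed
  from this[of "{1..b}"] show ?thesis by (auto intro: reach_cong)
qed

text \<open>Every move changes all entries by one constant modulo \<open>a\<close>. Conversely,
  constants and multiples of \<open>a\<close> are reachable displacements.\<close>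

lemma chip_equiv_iff:
  "(D, E) \<in> chip_equiv a b \<longleftrightarrow>
     D \<in> configs b \<and> E \<in> configs b \<and> (\<exists>c. \<forall>i\<in>{1..b}. int a dvd E i - D i - c)"
proof
  assume "(D, E) \<in> chip_equiv a b"
  then have path: "(D, E) \<in> (step a b)\<^sup>*" and conf: "D \<in> configs b" "E \<in> configs b"
    by (auto simp: chip_equiv_def)
  from path have "\<exists>c. \<forall>i\<in>{1..b}. int a dvd E i - D i - c"
  proof (induction rule: rtrancl_induct)
    case base
    then show ?case by (intro exI[of _ 0]) simp
  next
    case (step F G)
    then obtain c where c: "\<And>i. i \<in> {1..b} \<Longrightarrow> int a dvd F i - D i - c" by blast
    from step(2) obtain S where F: "F \<in> configs b" and S: "S \<subseteq> {1..b}"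
      and G: "G = fire a b S F \<or> G = borrow a b S F" by (auto simp: step_def moves_def)
    have "\<exists>d. \<forall>i\<in>{1..b}. int a dvd G i - F i - d"
    proof (cases "S = {}")
      case True
      then have "G = F" using G F fire_empty[OF F] borrow_fire[OF F, of a "{}"] by auto
      then show ?thesis by (intro exI[of _ 0]) simp
    next
      case False
      from G show ?thesis
      proof
        assume "G = fire a b S F"
        then show ?thesis
          by (intro exI[of _ "level a b (card S)"]) (auto simp: fire_eq_level[OF S False])
      next
        assume "G = borrow a b S F"
        then show ?thesis
          by (intro exI[of _ "- level a b (card S)"]) (auto simp: borrow_eq_level[OF F S False])
      qed
    qed
    then obtain d where d: "\<And>i. i \<in> {1..b} \<Longrightarrow> int a dvd G i - F i - d" by blast
    show ?case
    proof (intro exI[of _ "c + d"] ballI)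
      fix i assume i: "i \<in> {1..b}"
      from dvd_add[OF c[OF i] d[OF i]] show "int a dvd G i - D i - (c + d)"
        by (simp add: algebra_simps)
    qed
  qed
  with conf show "D \<in> configs b \<and> E \<in> configs b \<and> (\<exists>c. \<forall>i\<in>{1..b}. int a dvd E i - D i - c)"
    by simp
next
  assume "D \<in> configs b \<and> E \<in> configs b \<and> (\<exists>c. \<forall>i\<in>{1..b}. int a dvd E i - D i - c)"
  then obtain c where conf: "D \<in> configs b" "E \<in> configs b"
    and c: "\<And>i. i \<in> {1..b} \<Longrightarrow> int a dvd E i - D i - c" by blast
  have "(\<lambda>i. c + int a * ((E i - D i - c) div int a)) \<in> reach"
    by (rule reach_add[OF reach_const reach_multiples])
  then have "(\<lambda>i. E i - D i) \<in> reach"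
    by (rule reach_cong) (use c in simp)
  then have "(D, \<lambda>i\<in>{1..b}. D i + (E i - D i)) \<in> (step a b)\<^sup>*"
    using conf by (auto simp: reach_def)
  then show "(D, E) \<in> chip_equiv a b"
    using conf by (simp add: chip_equiv_def restrict_config)
qed

section \<open>The group of classes\<close>

text \<open>Differences to the last entry modulo \<open>a\<close> forget exactly the common
  constant, so \<open>f\<close> is a surjective homomorphism with kernel relation
  \<open>chip_equiv\<close>.\<close>

lemma chip_group_structure:
  shows "(\<lambda>D E. chip_equiv a b `` {D \<otimes>\<^bsub>vec_group b\<^esub> E}) respects2 chip_equiv a b" (is ?A)
    and "group (chip_group a b)" (is ?B)
    and "chip_group a b \<cong> product_group {1..b - 1} (\<lambda>_. integer_mod_group a)" (is ?C)
proof -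
  define f where "f = (\<lambda>D. \<lambda>i\<in>{1..b - 1}. (D i - D b) mod int a :: int)"
  let ?H = "product_group {1..b - 1} (\<lambda>_. integer_mod_group a)"
  have carrier: "carrier (integer_mod_group a) = {0..<int a}"
    using a by (simp add: carrier_integer_mod_group)
  have hom: "f \<in> hom (vec_group b) ?H"
  proof (rule homI)
    fix D E
    have "(D i + E i - (D b + E b)) mod int a = ((D i - D b) mod int a + (E i - E b) mod int a) mod int a"
      for i by (simp add: mod_add_eq algebra_simps)
    then show "f (D \<otimes>\<^bsub>vec_group b\<^esub> E) = f D \<otimes>\<^bsub>?H\<^esub> f E"
      using b unfolding vec_group_mult f_def by (auto simp: fun_eq_iff)
  qed (use a in \<open>auto simp: f_def carrier\<close>)
  have surj: "f ` carrier (vec_group b) = carrier ?H"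
  proof
    show "f ` carrier (vec_group b) \<subseteq> carrier ?H" using hom by (auto simp: hom_def)
    show "carrier ?H \<subseteq> f ` carrier (vec_group b)"
    proof
      fix h assume "h \<in> carrier ?H"
      then have h: "h \<in> {1..b - 1} \<rightarrow>\<^sub>E {0..<int a}" by (simp add: carrier)
      \<comment> \<open>The last entry is normalised to \<open>0\<close>, so the differences to it
        are the prescribed residues.\<close>
      let ?D = "\<lambda>i\<in>{1..b}. if i = b then 0 else h i"
      have "f ?D i = h i" for i
      proof (cases "i \<in> {1..b - 1}")
        case True
        then have "h i \<in> {0..<int a}" "i \<noteq> b" "i \<in> {1..b}" using h b by auto
        then show ?thesis using True b by (simp add: f_def)
      next
        case False
        then show ?thesis using PiE_arb[OF h False] unfolding f_def by (simp only: restrict_def if_False)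
      qed
      then have "h = f ?D" by auto
      moreover have "?D \<in> carrier (vec_group b)" by simp
      ultimately show "h \<in> f ` carrier (vec_group b)" by blast
    qed
  qed
  have ker: "(D, E) \<in> chip_equiv a b \<longleftrightarrow>
      D \<in> carrier (vec_group b) \<and> E \<in> carrier (vec_group b) \<and> f D = f E" for D E
  proof -
    have "(\<exists>c. \<forall>i\<in>{1..b}. int a dvd E i - D i - c) \<longleftrightarrow> f D = f E"
    proof
      assume "\<exists>c. \<forall>i\<in>{1..b}. int a dvd E i - D i - c"
      then obtain c where c: "\<And>i. i \<in> {1..b} \<Longrightarrow> int a dvd E i - D i - c" by blast
      have "(D i - D b) mod int a = (E i - E b) mod int a" if "i \<in> {1..b}" for i
        using dvd_diff[OF c[of b] c[OF that]] b by (simp add: mod_eq_dvd_iff algebra_simps)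
      then show "f D = f E" unfolding f_def by (intro restrict_ext) auto
    next
      assume eq: "f D = f E"
      have "int a dvd E i - D i - (E b - D b)" if i: "i \<in> {1..b}" for i
      proof (cases "i = b")
        case False
        then have "(E i - E b) mod int a = (D i - D b) mod int a"
          using fun_cong[OF eq, of i] i unfolding f_def by (simp add: Suc_le_eq split: if_splits)
        then show ?thesis by (simp add: mod_eq_dvd_iff algebra_simps)
      qed simp
      then show "\<exists>c. \<forall>i\<in>{1..b}. int a dvd E i - D i - c" by blast
    qed
    then show ?thesis by (simp add: chip_equiv_iff configs_def del: carrier_product_group)
  qed
  have groups: "group (vec_group b)" "group ?H" by simp_all
  note * = quotient_by_kernel[OF groups hom surj ker]
  show ?A by (rule *(1))
  show ?B unfolding chip_group_def configs_def by (rule *(2))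
  show ?C unfolding chip_group_def configs_def by (rule *(3))
qed

section \<open>Stability by counting\<close>

text \<open>Entries outside \<open>S\<close> gain the nonnegative amount
  \<open>level a b (card S)\<close>, so only those in \<open>S\<close> can become negative.\<close>

lemma legal_fire_iff:
  assumes S: "S \<subseteq> {1..b}" "S \<noteq> {}" and D: "nonneg b D"
  shows "legal b (fire a b S) D \<longleftrightarrow> (\<forall>i\<in>S. int a - level a b (card S) \<le> D i)"
proof -
  have "0 \<le> fire a b S D i \<longleftrightarrow> (i \<in> S \<longrightarrow> int a - level a b (card S) \<le> D i)" if "i \<in> {1..b}" for i
    using that D level_nonneg[OF card_bounds(1)[OF S]]
    by (auto simp: fire_eq_level[OF S] nonneg_def)
  then show ?thesis using S(1) D unfolding legal_def nonneg_def by blast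
qed

text \<open>All entries of \<open>S\<close> face the same threshold, so a legal set of size
  \<open>s\<close> exists iff at least \<open>s\<close> entries reach it.\<close>

lemma k_stable_iff_card:
  "k_stable a b k D \<longleftrightarrow> D \<in> configs b \<and> nonneg b D \<and>
     (\<forall>s\<in>{1..k + 1}. card {i\<in>{1..b}. int a - level a b s \<le> D i} < s)"
proof (intro iffI conjI ballI)
  assume stable: "k_stable a b k D"
  then show D: "D \<in> configs b" "nonneg b D" by (auto simp: k_stable_def)
  fix s assume s: "s \<in> {1..k + 1}"
  show "card {i\<in>{1..b}. int a - level a b s \<le> D i} < s"
  proof (rule ccontr)
    assume "\<not> ?thesis"
    then have "s \<le> card {i\<in>{1..b}. int a - level a b s \<le> D i}" by simp
    then obtain S where S: "S \<subseteq> {i\<in>{1..b}. int a - level a b s \<le> D i}" "card S = s"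
      by (rule obtain_subset_with_card_n)
    then have "S \<subseteq> {1..b}" "S \<noteq> {}" using s by auto
    moreover from this have "legal b (fire a b S) D"
      using S D by (subst legal_fire_iff) auto
    ultimately show False using stable S(2) s unfolding k_stable_def by auto
  qed
next
  assume *: "D \<in> configs b \<and> nonneg b D \<and>
     (\<forall>s\<in>{1..k + 1}. card {i\<in>{1..b}. int a - level a b s \<le> D i} < s)"
  show "k_stable a b k D" unfolding k_stable_def
  proof (intro conjI allI impI notI)
    fix S assume S: "S \<subseteq> {1..b}" "0 < card S \<and> card S \<le> k + 1" and legal: "legal b (fire a b S) D"
    then have "S \<noteq> {}" by auto
    then have "S \<subseteq> {i\<in>{1..b}. int a - level a b (card S) \<le> D i}"
      using legal S * by (subst (asm) legal_fire_iff) auto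
    then have "card S \<le> card {i\<in>{1..b}. int a - level a b (card S) \<le> D i}"
      by (intro card_mono) auto
    then show False using bspec[OF conjunct2[OF conjunct2[OF *]], of "card S"] S by simp
  qed (use * in auto)
qed

lemma k_stable_range:
  assumes "k_stable a b k D" "i \<in> {1..b}"
  shows "0 \<le> D i" "D i < int a"
proof -
  show "0 \<le> D i" using assms by (auto simp: k_stable_def nonneg_def)
  have "card {i\<in>{1..b}. int a - level a b 1 \<le> D i} < 1"
    using assms(1) unfolding k_stable_iff_card by (auto dest: bspec[of _ _ 1])
  then have "{i\<in>{1..b}. int a - level a b 1 \<le> D i} = {}" by simp
  then have "i \<notin> {i\<in>{1..b}. int a - level a b 1 \<le> D i}" by (simp only: empty_iff not_False_eq_True)
  then have "D i < int a - level a b 1" using assms(2) by simp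
  then show "D i < int a" using level_nonneg[of 1] by simp
qed

section \<open>Cutting the circle\<close>

text \<open>Read the entries of \<open>D\<close> as points on a circle of length \<open>a\<close>. The reduced configurations
  of a class are obtained by cutting this circle at the various places \<open>z\<close>; for \<open>D\<close> with entries
  in \<open>{0..<a}\<close> and \<open>z \<ge> 0\<close>, \<open>points D z\<close> counts the points between \<open>0\<close> and \<open>z\<close> on the universal cover.\<close>

definition cut :: "(nat \<Rightarrow> int) \<Rightarrow> int \<Rightarrow> (nat \<Rightarrow> int)" where
  "cut D z = (\<lambda>i\<in>{1..b}. (D i - z) mod int a)"

definition points :: "(nat \<Rightarrow> int) \<Rightarrow> int \<Rightarrow> int" where
  "points D z = - (\<Sum>i\<in>{1..b}. (D i - z) div int a)"

lemma cut_in_configs: "cut D z \<in> configs b"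
  by (simp add: cut_def)

lemma nonneg_cut: "nonneg b (cut D z)"
  using a by (simp add: nonneg_def cut_def)

lemma mono_points: "mono (points D)"
  unfolding points_def by (intro monoI le_imp_neg_le sum_mono zdiv_mono1) (use a in auto)

text \<open>With \<open>m < a\<close>, each point of the circle meets the window of length
  \<open>m\<close> before \<open>z\<close> at most once; measured from \<open>z\<close>, these are
  the residues from \<open>a - m\<close> on.\<close>

lemma points_diff:
  assumes "0 \<le> m" "m < int a"
  shows "points D z - points D (z - m) = int (card {i\<in>{1..b}. int a - m \<le> cut D z i})"
proof -
  have "(x + m) div int a - x div int a = (if int a - m \<le> x mod int a then 1 else 0)" for x
  proof -
    have "(x + m) div int a = (x mod int a + m + int a * (x div int a)) div int a"
      by (simp add: algebra_simps)
    also have "\<dots> = x div int a + (x mod int a + m) div int a"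
      using a by (intro div_mult_self2) simp
    also have "(x mod int a + m) div int a = (if int a - m \<le> x mod int a then 1 else 0)"
    proof (cases "int a - m \<le> x mod int a")
      case True
      have "x mod int a < int a" using a by simp
      then have "(x mod int a + m) div int a = 1"
        by (intro int_div_pos_eq[where r = "x mod int a + m - int a"]) (use True assms in linarith)+
      then show ?thesis using True by simp
    next
      case False
      have "0 \<le> x mod int a" using a by simp
      then show ?thesis using False assms by (simp add: div_pos_pos_trivial)
    qed
    finally show ?thesis by simp
  qed
  from this[of "D _ - z"]
  have "points D z - points D (z - m)
      = (\<Sum>i\<in>{1..b}. if int a - m \<le> cut D z i then 1 else 0)"
    unfolding points_def by (simp add: sum_subtractf[symmetric] cut_def algebra_simps)
  then show ?thesis by (simp add: sum.If_cases Int_def conj_commute)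
qed

text \<open>\<open>k < b\<close> keeps each window length \<open>level a b s\<close> below
  \<open>a\<close>, so \<open>points_diff\<close> turns threshold counts into window counts.\<close>

lemma k_stable_cut_iff:
  assumes "k < b"
  shows "k_stable a b k (cut D z) \<longleftrightarrow>
    (\<forall>s\<in>{1..k + 1}. points D z - points D (z - level a b s) < int s)"
proof -
  have "points D z - points D (z - level a b s) = int (card {i\<in>{1..b}. int a - level a b s \<le> cut D z i})"
    if "s \<in> {1..k + 1}" for s
    using that assms by (intro points_diff level_nonneg level_less_a) auto
  then show ?thesis by (simp add: k_stable_iff_card cut_in_configs nonneg_cut)
qed

text \<open>Division with remainder, summed over all entries: the chips gained by a cut depend only
  on \<open>z\<close> and \<open>points D z\<close>.\<close>

lemma sum_cut: "sum (cut D z) {1..b} = sum D {1..b} - int b * z + int a * points D z"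
proof -
  have "sum (cut D z) {1..b} = (\<Sum>i\<in>{1..b}. D i - z - int a * ((D i - z) div int a))"
    unfolding cut_def by (intro sum.cong) (auto simp: minus_mult_div_eq_mod)
  also have "\<dots> = sum D {1..b} - int b * z + int a * points D z"
    by (simp add: points_def sum_subtractf sum_distrib_left)
  finally show ?thesis .
qed

lemma points_eq_card:
  assumes range: "\<And>i. i \<in> {1..b} \<Longrightarrow> 0 \<le> D i \<and> D i < int a" and z: "0 \<le> z" "z \<le> int a"
  shows "points D z = int (card {i\<in>{1..b}. D i < z})"
proof -
  have "- ((D i - z) div int a) = (if D i < z then 1 else 0)" if "i \<in> {1..b}" for i
  proof (cases "D i < z")
    case True
    then have "(D i - z) div int a = -1"
      using range[OF that] z by (intro int_div_pos_eq[where r = "D i - z + int a"]) auto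
    then show ?thesis using True by simp
  next
    case False
    then show ?thesis using range[OF that] z by (simp add: div_pos_pos_trivial)
  qed
  then have "points D z = (\<Sum>i\<in>{1..b}. if D i < z then 1 else 0)"
    unfolding points_def sum_negf[symmetric] by (intro sum.cong) auto
  then show ?thesis by (simp add: sum.If_cases Int_def conj_commute)
qed

lemma stable_equiv_cut:
  assumes D: "k_stable a b k D" and E: "k_stable a b k E" and equiv: "(D, E) \<in> chip_equiv a b"
  obtains m where "0 \<le> m" "m < int a" "E = cut D m"
proof -
  obtain c where c: "\<And>i. i \<in> {1..b} \<Longrightarrow> int a dvd E i - D i - c"
    using equiv unfolding chip_equiv_iff by blast
  have "E = cut D ((- c) mod int a)"
  proof (rule config_eqI[of _ b])
    fix i assume i: "i \<in> {1..b}"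
    have "(D i - (- c) mod int a) mod int a = (D i + c) mod int a"
      by (simp add: mod_diff_right_eq)
    also have "\<dots> = E i mod int a" using c[OF i]
      by (subst eq_commute) (simp add: mod_eq_dvd_iff algebra_simps)
    finally show "E i = cut D ((- c) mod int a) i"
      using i k_stable_range[OF E i] by (simp add: cut_def)
  qed (use E in \<open>auto simp: k_stable_def cut_in_configs\<close>)
  then show ?thesis using a by (intro that[of "(- c) mod int a"]) auto
qed

text \<open>Borrowing the set of entries below \<open>level a b t\<close> realises the cut there,
  provided there are exactly \<open>t\<close> of them. \<open>next_stable_cut\<close> finds such a
  \<open>t\<close> from the stable cut that gives \<open>E\<close>.\<close>

lemma stable_borrow_exists:
  assumes k: "k < b" and D: "k_stable a b k D" and E: "k_stable a b k E"
    and equiv: "(D, E) \<in> chip_equiv a b" and less: "sum D {1..b} < sum E {1..b}"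
  shows "\<exists>T\<subseteq>{1..b}. T \<noteq> {} \<and> legal b (borrow a b T) D \<and> k_stable a b k (borrow a b T D)"
proof -
  have conf: "D \<in> configs b" and nonneg: "nonneg b D"
    using D by (auto simp: k_stable_def)
  have range: "0 \<le> D i \<and> D i < int a" if "i \<in> {1..b}" for i
    using k_stable_range[OF D that] by auto
  obtain m where m: "0 \<le> m" "m < int a" and E_eq: "E = cut D m"
    using stable_equiv_cut[OF D E equiv] .
  \<comment> \<open>By \<open>sum_cut\<close>, having more chips means that \<open>m\<close> is
    strictly below \<open>points D m * a / b\<close>, hence at most the level of
    \<open>points D m\<close>.\<close>
  have gain: "m * int b < points D m * int a"
    using less unfolding E_eq sum_cut by (simp add: mult.commute)
  define t\<^sub>0 where "t\<^sub>0 = nat (points D m)"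
  have "0 < points D m * int a" using gain m by (auto intro: le_less_trans[rotated])
  then have "0 < points D m" using a by (simp add: zero_less_mult_iff)
  then have t\<^sub>0: "points D m = int t\<^sub>0" "0 < t\<^sub>0" by (auto simp: t\<^sub>0_def)
  \<comment> \<open>One full turn contains all \<open>b\<close> points; this bounds
    \<open>t\<^sub>0\<close> and makes \<open>level a b b = a - 1\<close> an admissible last
    candidate.\<close>
  have le_b: "points D z \<le> int b" if "z \<le> int a" for z
  proof -
    have "card {i\<in>{1..b}. D i < int a} \<le> card {1..b}" by (rule card_mono) auto
    then have "points D (int a) \<le> int b"
      using points_eq_card[of D "int a"] range by simp
    then show ?thesis using monoD[OF mono_points that, of D] by linarith
  qed
  have stable: "\<forall>s\<in>{1..k + 1}. points D m - points D (m - level a b s) < int s"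
    using E unfolding E_eq k_stable_cut_iff[OF k] .
  have "\<exists>t\<in>{1..b}. points D (level a b t) = int t \<and> (\<forall>s\<in>{1..k + 1}.
      points D (level a b t) - points D (level a b t - level a b s) < int s)"
    using t\<^sub>0 m gain le_b[of m] le_b[of "level a b b"] level_full[OF b, of a] stable
    by (intro next_stable_cut[where y = m and t\<^sub>0 = t\<^sub>0] mono_points mono_level
        level_superadditive level_subadditive b) (auto simp: le_level_iff[OF b])
  then obtain t where t: "t \<in> {1..b}" "points D (level a b t) = int t"
    and stable': "k_stable a b k (cut D (level a b t))"
    using k_stable_cut_iff[OF k] by blast
  have lev: "0 \<le> level a b t" "level a b t < int a"
    using t level_nonneg level_less_a by auto
  define T where "T = {i\<in>{1..b}. D i < level a b t}"
  have card: "card T = t" using points_eq_card[of D "level a b t"] range lev t unfolding T_def by simp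
  have T: "T \<subseteq> {1..b}" unfolding T_def by blast
  have "T \<noteq> {}" using card t(1) by auto
  note T = T this
  have borrow_eq_cut: "borrow a b T D = cut D (level a b t)"
    unfolding borrow_eq_level[OF conf T] card
  proof (rule config_eqI[of _ b])
    fix i assume i: "i \<in> {1..b}"
    \<comment> \<open>Exactly the entries of \<open>T\<close> become negative after the shift, and
      adding \<open>a\<close> restores the residue.\<close>
    have "(D i - level a b t) mod int a = D i - level a b t + (if i \<in> T then int a else 0)"
    proof (cases "i \<in> T")
      case True
      have "(D i - level a b t) mod int a = (D i - level a b t + int a) mod int a" by simp
      then show ?thesis using True range[OF i] lev by (simp add: T_def del: mod_add_self2)
    next
      case False
      then show ?thesis using i range[OF i] lev by (simp add: T_def)
    qed
    then show "(\<lambda>i\<in>{1..b}. D i - level a b t + (if i \<in> T then int a else 0)) i = cut D (level a b t) i"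
      using i by (simp add: cut_def)
  qed (simp_all add: cut_in_configs)
  show ?thesis
    using T stable' nonneg by (intro exI[of _ T]) (auto simp: borrow_eq_cut legal_def nonneg_cut)
qed

section \<open>Skeletal configurations and legal paths\<close>

text \<open>By \<open>stable_borrow_exists\<close> neither can have fewer chips. Equal totals force
  \<open>b * m = a * points D m\<close> for the cut \<open>m\<close> taking \<open>D\<close> to
  \<open>E\<close>, and coprimality with \<open>m < a\<close> gives \<open>m = 0\<close>.\<close>

lemma k_skeletal_unique:
  assumes k: "k < b" and D: "k_skeletal a b k D" and E: "k_skeletal a b k E"
    and equiv: "(D, E) \<in> chip_equiv a b"
  shows "D = E"
proof -
  have not_less: "\<not> sum D {1..b} < sum E {1..b}"
    if "k_skeletal a b k D" "k_skeletal a b k E" "(D, E) \<in> chip_equiv a b" for D E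
    using stable_borrow_exists[OF k, of D E] that unfolding k_skeletal_def by blast
  have "(E, D) \<in> chip_equiv a b" using equiv equiv_chip_equiv by (metis equivE symD)
  then have sum: "sum D {1..b} = sum E {1..b}"
    using not_less[OF D E equiv] not_less[OF E D] by simp
  have stable: "k_stable a b k D" "k_stable a b k E"
    using D E by (auto simp: k_skeletal_def)
  obtain m where m: "0 \<le> m" "m < int a" and E_eq: "E = cut D m"
    using stable_equiv_cut[OF stable equiv] .
  have "int b * m = int a * points D m"
    using sum unfolding E_eq sum_cut by simp
  then have "int a dvd m"
    using coprime by (metis coprime_dvd_mult_right_iff coprime_int_iff dvd_triv_left)
  then have "m = 0" using m by (metis zdvd_not_zless order_le_less)
  show ?thesis
  proof (rule config_eqI[of _ b])
    fix i assume "i \<in> {1..b}"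
    then show "D i = E i"
      using k_stable_range[OF stable(1)] by (simp add: E_eq cut_def \<open>m = 0\<close>)
  qed (use stable in \<open>auto simp: k_stable_def\<close>)
qed

lemma fire_equiv:
  assumes "D \<in> configs b" "S \<subseteq> {1..b}"
  shows "(D, fire a b S D) \<in> chip_equiv a b"
proof -
  have "(D, fire a b S D) \<in> step a b" using assms by (auto simp: step_def moves_def)
  then show ?thesis using assms fire_in_configs by (auto simp: chip_equiv_def)
qed

text \<open>Legality constrains both endpoints, hence passes to the inverse move. This lets a
  stabilising path be run backwards.\<close>

lemma sym_legal_step: "sym (legal_step a b)"
proof (rule symI)
  fix D E assume "(D, E) \<in> legal_step a b"
  then obtain S where D: "D \<in> configs b" and S: "S \<in> Pow {1..b}"
    and E: "E = fire a b S D \<or> E = borrow a b S D" and nonneg: "nonneg b D" "nonneg b E"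
    by (auto simp: legal_step_def moves_def legal_def)
  have "E \<in> configs b" using D E fire_in_configs borrow_in_configs by metis
  moreover have "D = borrow a b S E \<or> D = fire a b S E"
    using D E borrow_fire fire_borrow by metis
  ultimately show "(E, D) \<in> legal_step a b"
    using S nonneg by (auto simp: legal_step_def moves_def legal_def)
qed

lemma legal_stabilization:
  assumes "D \<in> configs b" "nonneg b D"
  shows "\<exists>E. (D, E) \<in> (legal_step a b)\<^sup>* \<and> (D, E) \<in> chip_equiv a b \<and> k_stable a b k E"
  using assms
proof (induction "nat (sum D {1..b})" arbitrary: D rule: less_induct)
  case less
  show ?case
  proof (cases "k_stable a b k D")
    case True
    then show ?thesis
      using less.prems equiv_class_self[OF equiv_chip_equiv] by blast
  next
    case False
    then obtain S where S: "S \<subseteq> {1..b}" "0 < card S" and legal: "legal b (fire a b S) D"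
      using less.prems unfolding k_stable_def by blast
    let ?F = "fire a b S D"
    have F: "?F \<in> configs b" "nonneg b ?F"
      using less.prems legal fire_in_configs by (auto simp: legal_def)
    have "sum ?F {1..b} < sum D {1..b}" using S by (intro sum_fire_less) auto
    moreover have "0 \<le> sum ?F {1..b}" using F(2) by (auto simp: nonneg_def intro: sum_nonneg)
    ultimately have "nat (sum ?F {1..b}) < nat (sum D {1..b})" by simp
    from less.hyps[OF this F] obtain E where E: "(?F, E) \<in> (legal_step a b)\<^sup>*"
      "(?F, E) \<in> chip_equiv a b" "k_stable a b k E" by blast
    have "(D, ?F) \<in> legal_step a b"
      using less.prems S legal by (auto simp: legal_step_def moves_def)
    then have "(D, E) \<in> (legal_step a b)\<^sup>*" using E(1) by (rule converse_rtrancl_into_rtrancl)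
    moreover have "(D, E) \<in> chip_equiv a b"
      using fire_equiv[OF less.prems(1) S(1)] E(2) equiv_chip_equiv by (metis equivE transD)
    ultimately show ?thesis using E(3) by blast
  qed
qed

text \<open>For \<open>k = b - 1\<close> every nonempty set gives a firing move, so after a legal
  borrow of \<open>T\<close>, firing \<open>T\<close> back is legal.\<close>

lemma fully_stable_skeletal:
  assumes stable: "k_stable a b (b - 1) D"
  shows "k_skeletal a b (b - 1) D"
  unfolding k_skeletal_def
proof (intro conjI allI impI notI)
  fix T assume T: "T \<subseteq> {1..b}" "T \<noteq> {} \<and> legal b (borrow a b T) D"
    and stable': "k_stable a b (b - 1) (borrow a b T D)"
  have "legal b (fire a b T) (borrow a b T D)"
    using T stable by (auto simp: legal_def fire_borrow k_stable_def)
  moreover have "0 < card T" "card T \<le> b - 1 + 1"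
    using card_bounds[of T] T b by auto
  ultimately show False using stable' T(1) unfolding k_stable_def by blast
qed (rule stable)

lemma class_has_nonneg:
  assumes "X \<in> configs b // chip_equiv a b"
  shows "\<exists>D\<in>X. nonneg b D"
proof -
  obtain D where D: "D \<in> configs b" "X = chip_equiv a b `` {D}"
    using assms by (auto simp: quotient_def)
  \<comment> \<open>Reducing every entry modulo \<open>a\<close> gives a nonnegative representative,
    with constant \<open>0\<close>.\<close>
  have "int a dvd cut D 0 i - D i - 0" if "i \<in> {1..b}" for i
    using that by (simp add: cut_def mod_eq_dvd_iff[symmetric])
  then have "(D, cut D 0) \<in> chip_equiv a b"
    using D(1) cut_in_configs unfolding chip_equiv_iff by blast
  then show ?thesis using D(2) nonneg_cut by blast
qed

lemma legal_path:
  assumes X: "X \<in> configs b // chip_equiv a b" and D: "D \<in> X" "nonneg b D"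
    and D': "D' \<in> X" "nonneg b D'"
  shows "(D, D') \<in> (legal_step a b)\<^sup>*"
proof -
  have equiv: "(D, D') \<in> chip_equiv a b"
    using quotient_eq_iff[OF equiv_chip_equiv X X D(1) D'(1)] by simp
  then have conf: "D \<in> configs b" "D' \<in> configs b" by (auto simp: chip_equiv_def)
  obtain E where E: "(D, E) \<in> (legal_step a b)\<^sup>*" "(D, E) \<in> chip_equiv a b" "k_stable a b (b - 1) E"
    using legal_stabilization[OF conf(1) D(2)] by blast
  obtain E' where E': "(D', E') \<in> (legal_step a b)\<^sup>*" "(D', E') \<in> chip_equiv a b"
    "k_stable a b (b - 1) E'"
    using legal_stabilization[OF conf(2) D'(2)] by blast
  have "(E, E') \<in> chip_equiv a b"
    using equiv E(2) E'(2) equiv_chip_equiv by (metis equivE symD transD)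
  then have "E = E'"
    using k_skeletal_unique[of "b - 1" E E'] fully_stable_skeletal E(3) E'(3) b by simp
  moreover have "(E', D') \<in> (legal_step a b)\<^sup>*"
    using E'(1) sym_rtrancl[OF sym_legal_step] by (blast dest: symD)
  ultimately show ?thesis using E(1) by (metis rtrancl_trans)
qed

text \<open>Lets a stable configuration with the most chips be chosen in a class.\<close>

lemma finite_k_stable: "finite {D. k_stable a b k D}"
proof (rule finite_subset)
  show "{D. k_stable a b k D} \<subseteq> {1..b} \<rightarrow>\<^sub>E {0..<int a}"
  proof
    fix D assume "D \<in> {D. k_stable a b k D}"
    then have D: "k_stable a b k D" by simp
    then have "D \<in> {1..b} \<rightarrow>\<^sub>E UNIV" unfolding k_stable_def configs_eq by blast
    then show "D \<in> {1..b} \<rightarrow>\<^sub>E {0..<int a}"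
      using k_stable_range[OF D] by (auto simp: PiE_iff)
  qed
qed (simp add: finite_PiE)

lemma skeletal_in_class:
  assumes k: "k < b" and X: "X \<in> configs b // chip_equiv a b"
  shows "\<exists>!D. D \<in> X \<and> k_skeletal a b k D"
proof (rule ex_ex1I)
  define K where "K = {D \<in> X. k_stable a b k D}"
  have in_conf: "D \<in> configs b" if "D \<in> X" for D
    using in_quotient_imp_subset[OF equiv_chip_equiv X] that by blast
  have "K \<noteq> {}"
  proof -
    obtain D where D: "D \<in> X" "nonneg b D" using class_has_nonneg[OF X] by blast
    then obtain E where "(D, E) \<in> chip_equiv a b" "k_stable a b k E"
      using legal_stabilization in_conf by blast
    then show ?thesis
      using D in_quotient_imp_closed[OF equiv_chip_equiv X] by (auto simp: K_def)
  qed
  moreover have "finite K" by (rule finite_subset[OF _ finite_k_stable]) (auto simp: K_def)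
  ultimately obtain D where D: "D \<in> K" and max: "\<And>E. E \<in> K \<Longrightarrow> sum E {1..b} \<le> sum D {1..b}"
    using Max_in[of "(\<lambda>E. sum E {1..b}) ` K"] Max_ge[of "(\<lambda>E. sum E {1..b}) ` K"] by fastforce
  have "k_skeletal a b k D" unfolding k_skeletal_def
  proof (intro conjI allI impI notI)
    fix T assume T: "T \<subseteq> {1..b}" "T \<noteq> {} \<and> legal b (borrow a b T) D"
      and stable: "k_stable a b k (borrow a b T D)"
    have conf: "D \<in> configs b" using D in_conf by (auto simp: K_def)
    have "(borrow a b T D, D) \<in> chip_equiv a b"
      using fire_equiv[of "borrow a b T D" T] T(1) conf by (simp add: borrow_in_configs fire_borrow)
    then have "(D, borrow a b T D) \<in> chip_equiv a b" using equiv_chip_equiv by (metis equivE symD)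
    then have "borrow a b T D \<in> K"
      using stable D in_quotient_imp_closed[OF equiv_chip_equiv X] by (auto simp: K_def)
    then show False using max sum_borrow_greater[OF conf T(1)] T(2) by fastforce
  qed (use D in \<open>simp add: K_def\<close>)
  then show "\<exists>D. D \<in> X \<and> k_skeletal a b k D" using D by (auto simp: K_def)
next
  fix D E assume "D \<in> X \<and> k_skeletal a b k D" "E \<in> X \<and> k_skeletal a b k E"
  then show "D = E"
    using quotient_eq_iff[OF equiv_chip_equiv X X] k_skeletal_unique[OF k] by blast
qed

end

theorem theorem1p9:
  fixes a b :: nat
  assumes "0 < a" and "0 < b" and "coprime a b"
  shows "((\<lambda>D E. chip_equiv a b `` {D \<otimes>\<^bsub>vec_group b\<^esub> E}) respects2 chip_equiv a b
          \<and> group (chip_group a b)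
          \<and> chip_group a b \<cong> product_group {1..b - 1} (\<lambda>_. integer_mod_group a))
       \<and> (\<forall>X \<in> configs b // chip_equiv a b. \<exists>D\<in>X. nonneg b D)
       \<and> (\<forall>X \<in> configs b // chip_equiv a b. \<forall>D\<in>X. \<forall>D'\<in>X.
            nonneg b D \<and> nonneg b D' \<longrightarrow> (D, D') \<in> (legal_step a b)\<^sup>*)
       \<and> (\<forall>k<b. \<forall>X \<in> configs b // chip_equiv a b. \<exists>!D. D \<in> X \<and> k_skeletal a b k D)"
  using chip_group_structure[OF assms] class_has_nonneg[OF assms] legal_path[OF assms]
    skeletal_in_class[OF assms] by blast

end
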